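(* Let $W\in\mathbb{R}^{n\times n}$ be symmetric positive definite, let $T\in\mathbb{R}^{n\times n}$ be symmetric positive semidefinite, and let $$0\leqslant \mu_1\leqslant\cdots\leqslant\mu_r<1\leqslant\mu_{r+1}\leqslant\cdots\leqslant\mu_n$$ be the eigenvalues (counted with multiplicity) of $S=W^{-\frac12}TW^{-\frac12}$, where $1\le r<n$. For $\alpha,\beta>0$ define $$\sigma(\alpha,\beta)=\max_{\mu\in\sigma(S)}\left|\frac{\mu-\beta}{1+\beta\mu}\right|\cdot\max_{\mu\in\sigma(S)}\left|\frac{1-\alpha\mu}{\alpha+\mu}\right|,$$ where $\sigma(S)$ denotes the spectrum of $S$. Let $$(\alpha^*,\beta^* )=\operatorname{arg\,min}_{\alpha,\beta>0}\sigma(\alpha,\beta).$$ Then $$\alpha^*=\frac{\gamma+\sqrt{\gamma^2+\eta^2}}{\eta}\quad\text{and}\quad\beta^*=\frac{1}{\alpha^*},$$ where $\eta=\mu_1+\mu_n$ and $\gamma=1-\mu_1\mu_n$.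
   Context: The quantity $\sigma(\alpha,\beta)$ is an upper bound for the spectral radius of the iteration matrix $\mathcal{G}_{\alpha,\beta}=(W+\beta T)^{-1}(T-\beta W)(\alpha W+T)^{-1}(W-\alpha T)$ of the TTSCSP iteration method for solving $(W+iT)u=b$. Here $\operatorname{arg\,min}$ denotes the minimizing pair over all $\alpha>0$, $\beta>0$. *)

theory Defs
  imports "HOL-Analysis.Analysis"
begin

definition positive_definite :: "real ^ 'n ^ 'n \<Rightarrow> bool" where
  "positive_definite A \<longleftrightarrow> transpose A = A \<and> (\<forall>x. x \<noteq> 0 \<longrightarrow> x \<bullet> (A *v x) > 0)"

definition positive_semidefinite :: "real ^ 'n ^ 'n \<Rightarrow> bool" where
  "positive_semidefinite A \<longleftrightarrow> transpose A = A \<and> (\<forall>x. x \<bullet> (A *v x) \<ge> 0)"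

(* The definite description is proper for every positive definite W;
   see positive_definite_sqrt_unique below. *)
definition matrix_sqrt :: "real ^ 'n ^ 'n \<Rightarrow> real ^ 'n ^ 'n" where
  "matrix_sqrt W = (THE R. positive_definite R \<and> R ** R = W)"

definition spectrum :: "real ^ 'n ^ 'n \<Rightarrow> real set" where
  "spectrum A = {k. \<exists>v. v \<noteq> 0 \<and> A *v v = k *\<^sub>R v}"

(* mu 1, ..., mu n is a list of all eigenvalues, each repeated according to its algebraic
   multiplicity: the characteristic polynomial of A is the product of the x - mu i. *)
definition eigenvalues_with_multiplicity :: "real ^ 'n ^ 'n \<Rightarrow> (nat \<Rightarrow> real) \<Rightarrow> bool" where
  "eigenvalues_with_multiplicity A \<mu> \<longleftrightarrow>
     (\<forall>x. det (mat x - A) = (\<Prod>i = 1..CARD('n). x - \<mu> i))"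

definition ttscsp_bound :: "real ^ 'n ^ 'n \<Rightarrow> real \<Rightarrow> real \<Rightarrow> real" where
  "ttscsp_bound S \<alpha> \<beta> =
     (MAX \<mu>\<in>spectrum S. \<bar>(\<mu> - \<beta>) / (1 + \<beta> * \<mu>)\<bar>) *
     (MAX \<mu>\<in>spectrum S. \<bar>(1 - \<alpha> * \<mu>) / (\<alpha> + \<mu>)\<bar>)"


lemma inner_symmetric_matrix:
  fixes A :: "real ^ 'n ^ 'n"
  assumes "transpose A = A"
  shows "x \<bullet> (A *v y) = (A *v x) \<bullet> y"
proof -
  have "x \<bullet> (A *v y) = (transpose A *v x) \<bullet> y"
    by (simp only: transpose_matrix_vector dot_lmul_matrix)
  with assms show ?thesis by simp
qed

lemma symmetric_matrix_eigenvector: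
  fixes A :: "real ^ 'n ^ 'n"
  assumes sym: "transpose A = A" and V: "subspace V" "V \<noteq> {0}"
    and inv: "\<And>x. x \<in> V \<Longrightarrow> A *v x \<in> V"
  obtains v k where "v \<in> V" "norm v = 1" "A *v v = k *\<^sub>R v"
proof -
  define K where "K = V \<inter> sphere 0 1"
  have "compact K"
    unfolding K_def by (intro closed_Int_compact closed_subspace V compact_sphere)
  obtain u where u: "u \<in> V" "u \<noteq> 0"
    using V subspace_0 by blast
  have "(1 / norm u) *\<^sub>R u \<in> K"
    using u V by (auto simp: K_def subspace_scale)
  then have "K \<noteq> {}" by blast
  have "continuous_on K (\<lambda>x. x \<bullet> (A *v x))"
    by (intro continuous_intros)
  from continuous_attains_sup[OF \<open>compact K\<close> \<open>K \<noteq> {}\<close> this]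
  obtain v where v: "v \<in> K" and vmax: "\<And>y. y \<in> K \<Longrightarrow> y \<bullet> (A *v y) \<le> v \<bullet> (A *v v)"
    by blast
  define k where "k = v \<bullet> (A *v v)"
  have vV: "v \<in> V" and nv: "norm v = 1"
    using v by (auto simp: K_def)
  have vv: "v \<bullet> v = 1" using nv by (simp add: dot_square_norm)
  have bound: "y \<bullet> (A *v y) \<le> k * (y \<bullet> y)" if "y \<in> V" for y
  proof (cases "y = 0")
    case False
    have "(1 / norm y) *\<^sub>R y \<in> K"
      using that False V by (auto simp: K_def subspace_scale)
    from vmax[OF this] have "(y \<bullet> (A *v y)) / (norm y * norm y) \<le> k"
      by (simp add: k_def matrix_vector_mult_scaleR)
    then show ?thesis
      using False by (simp add: pos_divide_le_eq dot_square_norm power2_eq_square)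
  qed simp
  define w where "w = A *v v - k *\<^sub>R v"
  have wV: "w \<in> V"
    unfolding w_def by (intro subspace_diff subspace_scale V inv vV)
  define g where "g = k * (w \<bullet> w) - w \<bullet> (A *v w)"
  have "g \<ge> 0" using bound[OF wV] by (simp add: g_def)
  have vw: "v \<bullet> (A *v w) = w \<bullet> (A *v v)"
    by (metis inner_symmetric_matrix[OF sym] inner_commute)
  have ww: "w \<bullet> w = w \<bullet> (A *v v) - k * (w \<bullet> v)"
    by (subst (2) w_def) (simp add: inner_diff_right)
  have quad: "0 \<le> t * (t * g - 2 * (w \<bullet> w))" for t
  proof -
    have "v + t *\<^sub>R w \<in> V" by (intro subspace_add subspace_scale V vV wV)
    from bound[OF this]
    have "v \<bullet> (A *v v) + 2 * t * (w \<bullet> (A *v v)) + t * t * (w \<bullet> (A *v w))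
        \<le> k * (1 + 2 * t * (w \<bullet> v) + t * t * (w \<bullet> w))"
      by (simp add: matrix_vector_right_distrib matrix_vector_mult_scaleR inner_add_left
          inner_add_right vv vw inner_commute[of v w] algebra_simps)
    then show ?thesis by (simp add: g_def ww k_def algebra_simps)
  qed
  have "w = 0"
  proof (rule ccontr)
    assume "w \<noteq> 0"
    then have pos: "w \<bullet> w > 0" by simp
    define t where "t = (w \<bullet> w) / (g + 1)"
    have t: "t > 0" using pos \<open>g \<ge> 0\<close> by (simp add: t_def)
    have "t * (g + 1) = w \<bullet> w" using \<open>g \<ge> 0\<close> by (simp add: t_def)
    then have "t * g \<le> w \<bullet> w" using t by (simp add: algebra_simps)
    then have "t * g - 2 * (w \<bullet> w) < 0" using pos by linarith
    then have "t * (t * g - 2 * (w \<bullet> w)) < 0" using t by (rule mult_pos_neg[rotated])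
    with quad[of t] show False by linarith
  qed
  then have "A *v v = k *\<^sub>R v" by (simp add: w_def)
  with vV nv that show thesis by blast
qed

lemma symmetric_matrix_eigenbasis_subspace:
  fixes A :: "real ^ 'n ^ 'n"
  assumes sym: "transpose A = A"
  shows "\<lbrakk>subspace V; \<And>x. x \<in> V \<Longrightarrow> A *v x \<in> V\<rbrakk> \<Longrightarrow>
    \<exists>B. finite B \<and> pairwise orthogonal B \<and> B \<subseteq> V \<and> V \<subseteq> span B \<and>
        (\<forall>b\<in>B. norm b = 1 \<and> (\<exists>k. A *v b = k *\<^sub>R b))"
proof (induction "dim V" arbitrary: V rule: less_induct)
  case less
  show ?case
  proof (cases "V = {0}")
    case True
    then show ?thesis by (intro exI[of _ "{}"]) auto
  next
    case False
    obtain v k where v: "v \<in> V" "norm v = 1" "A *v v = k *\<^sub>R v"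
      using symmetric_matrix_eigenvector[OF sym less.prems(1) False less.prems(2)] by blast
    have vv: "v \<bullet> v = 1" using v by (simp add: dot_square_norm)
    define V' where "V' = V \<inter> {x. v \<bullet> x = 0}"
    have sub: "subspace V'"
      unfolding V'_def by (intro subspace_inter less.prems subspace_hyperplane)
    have "v \<notin> V'" using vv by (simp add: V'_def)
    then have "V' \<subset> V" using v(1) unfolding V'_def by blast
    then have "dim V' < dim V"
      by (intro dim_psubset) (simp add: sub less.prems span_eq_iff[THEN iffD2])
    moreover have "A *v x \<in> V'" if "x \<in> V'" for x
      using that less.prems(2) v(3) by (auto simp: V'_def inner_symmetric_matrix[OF sym])
    ultimately obtain B where B: "finite B" "pairwise orthogonal B" "B \<subseteq> V'" "V' \<subseteq> span B"
        "\<forall>b\<in>B. norm b = 1 \<and> (\<exists>k. A *v b = k *\<^sub>R b)"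
      using less.hyps[OF _ sub] by blast
    have "V \<subseteq> span (insert v B)"
    proof
      fix x assume x: "x \<in> V"
      have "x - (v \<bullet> x) *\<^sub>R v \<in> V'"
        using x v vv less.prems(1)
        by (auto simp: V'_def subspace_diff subspace_scale inner_diff_right)
      then show "x \<in> span (insert v B)"
        using B(4) by (auto simp: span_insert)
    qed
    moreover have "pairwise orthogonal (insert v B)"
      using B(2,3) by (auto simp: pairwise_insert V'_def orthogonal_def inner_commute)
    ultimately show ?thesis
      using B v by (intro exI[of _ "insert v B"]) (auto simp: V'_def)
  qed
qed

lemma symmetric_matrix_eigenbasis:
  fixes A :: "real ^ 'n ^ 'n"
  assumes "transpose A = A"
  obtains B l where "finite B" "pairwise orthogonal B" "span B = UNIV"
    "\<And>b. b \<in> B \<Longrightarrow> norm b = 1" "\<And>b. b \<in> B \<Longrightarrow> A *v b = l b *\<^sub>R b"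
proof -
  obtain B where "finite B" "pairwise orthogonal B" "UNIV \<subseteq> span B"
      "\<forall>b\<in>B. norm b = 1 \<and> (\<exists>k. A *v b = k *\<^sub>R b)"
    using symmetric_matrix_eigenbasis_subspace[OF assms subspace_UNIV] by auto
  moreover from this(4) obtain l where "\<forall>b\<in>B. A *v b = l b *\<^sub>R b" by metis
  ultimately show thesis using that by blast
qed

lemma matrix_eq_on_span:
  fixes A C :: "real ^ 'n ^ 'n"
  assumes "span B = UNIV" "\<And>b. b \<in> B \<Longrightarrow> A *v b = C *v b"
  shows "A = C"
proof -
  have "A *v x = C *v x" for x
    using linear_eq_on_span[of "(*v) A" "(*v) C" B x] assms
    by (auto simp: matrix_vector_mul_linear)
  then show ?thesis by (simp add: matrix_eq)
qed

lemma positive_definite_sqrt_exists: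
  fixes W :: "real ^ 'n ^ 'n"
  assumes W: "positive_definite W"
  obtains R where "positive_definite R" "R ** R = W"
proof -
  have sym: "transpose W = W" and pos: "\<And>x. x \<noteq> 0 \<Longrightarrow> x \<bullet> (W *v x) > 0"
    using W by (auto simp: positive_definite_def)
  obtain B l where B: "finite B" "pairwise orthogonal B" "span B = UNIV"
    and nB: "\<And>b. b \<in> B \<Longrightarrow> norm b = 1" and l: "\<And>b. b \<in> B \<Longrightarrow> W *v b = l b *\<^sub>R b"
    using symmetric_matrix_eigenbasis[OF sym] by blast
  have lpos: "l b > 0" if "b \<in> B" for b
    using pos[of b] nB[OF that] l[OF that] by (cases "b = 0") (auto simp: dot_square_norm)
  define f where "f x = (\<Sum>b\<in>B. (sqrt (l b) * (b \<bullet> x)) *\<^sub>R b)" for x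
  have lin: "linear f"
    by (rule linearI)
      (simp_all add: f_def inner_add_right distrib_left scaleR_add_left sum.distrib
        scaleR_sum_right mult.left_commute)
  define R where "R = matrix f"
  have R: "R *v x = f x" for x
    using fun_cong[OF matrix_vector_mul(2)[OF lin], of x] by (simp add: R_def)
  have inner_R: "x \<bullet> (R *v y) = (\<Sum>b\<in>B. sqrt (l b) * (b \<bullet> x) * (b \<bullet> y))" for x y
    by (simp add: R f_def inner_sum_right inner_commute mult_ac)
  have "x \<bullet> (transpose R *v y) = x \<bullet> (R *v y)" for x y
  proof -
    have "x \<bullet> (transpose R *v y) = y \<bullet> (R *v x)"
      by (simp only: transpose_matrix_vector dot_lmul_matrix inner_commute[of x])
    also have "\<dots> = x \<bullet> (R *v y)"
      unfolding inner_R by (intro sum.cong) simp_all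
    finally show ?thesis .
  qed
  then have symR: "transpose R = R"
    by (metis matrix_eq vector_eq_ldot)
  have "x \<bullet> (R *v x) > 0" if "x \<noteq> 0" for x
  proof -
    have "\<exists>b\<in>B. b \<bullet> x \<noteq> 0"
    proof (rule ccontr)
      assume "\<not> ?thesis"
      then have "\<And>b. b \<in> B \<Longrightarrow> orthogonal x b"
        by (simp add: orthogonal_def inner_commute)
      then have "orthogonal x x"
        using B(3) orthogonal_to_span[of x B x] by simp
      with that show False by (simp add: orthogonal_def)
    qed
    then obtain b where "b \<in> B" "b \<bullet> x \<noteq> 0" by blast
    then have "0 < sqrt (l b) * ((b \<bullet> x) * (b \<bullet> x))"
      using lpos[of b] by (simp flip: power2_eq_square)
    then have "0 < sqrt (l b) * (b \<bullet> x) * (b \<bullet> x)"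
      by (simp only: mult.assoc)
    moreover have "0 \<le> sqrt (l c) * (c \<bullet> x) * (c \<bullet> x)" if "c \<in> B" for c
      using lpos[OF that] by (simp add: mult.assoc)
    ultimately show ?thesis
      unfolding inner_R using \<open>b \<in> B\<close> B(1) by (intro sum_pos2)
  qed
  with symR have "positive_definite R" by (simp add: positive_definite_def)
  moreover have Rb: "R *v b = sqrt (l b) *\<^sub>R b" if "b \<in> B" for b
  proof -
    have "f b = (\<Sum>c\<in>B. if c = b then sqrt (l b) *\<^sub>R b else 0)"
      unfolding f_def
    proof (rule sum.cong)
      fix c assume "c \<in> B"
      then show "(sqrt (l c) * (c \<bullet> b)) *\<^sub>R c = (if c = b then sqrt (l b) *\<^sub>R b else 0)"
        using B(2) nB that by (auto simp: pairwise_def orthogonal_def dot_square_norm)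
    qed simp
    with that B(1) show ?thesis by (simp add: R)
  qed
  have "R ** R = W"
  proof (rule matrix_eq_on_span[OF B(3)])
    fix b assume b: "b \<in> B"
    then show "(R ** R) *v b = W *v b"
      using lpos[OF b]
      by (simp add: matrix_vector_mul_assoc[symmetric] Rb l matrix_vector_mult_scaleR)
  qed
  ultimately show thesis using that by blast
qed

lemma positive_definite_sqrt_inj:
  fixes P Q :: "real ^ 'n ^ 'n"
  assumes P: "positive_definite P" and Q: "positive_definite Q" and eq: "P ** P = Q ** Q"
  shows "P = Q"
proof -
  have sP: "transpose P = P" and sQ: "transpose Q = Q"
    using P Q by (auto simp: positive_definite_def)
  have sD: "transpose (P - Q) = P - Q"
    using sP sQ by (simp add: transpose_def vec_eq_iff)
  obtain B l where "finite B" "pairwise orthogonal B"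
    and B: "span B = UNIV" "\<And>b. b \<in> B \<Longrightarrow> norm b = 1"
    and l: "\<And>b. b \<in> B \<Longrightarrow> (P - Q) *v b = l b *\<^sub>R b"
    by (rule symmetric_matrix_eigenbasis[OF sD]) blast
  show ?thesis
  proof (rule matrix_eq_on_span[OF B(1)])
    fix b assume b: "b \<in> B"
    have b0: "b \<noteq> 0" using B(2)[OF b] by auto
    have Pb: "P *v b = Q *v b + l b *\<^sub>R b"
      using l[OF b] by (simp add: matrix_vector_mult_diff_rdistrib algebra_simps)
    have "(P *v b) \<bullet> (P *v b) = (Q *v b) \<bullet> (Q *v b)"
    proof -
      have "(P *v b) \<bullet> (P *v b) = b \<bullet> ((P ** P) *v b)"
        by (simp only: inner_symmetric_matrix[OF sP] flip: matrix_vector_mul_assoc)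
      also have "\<dots> = (Q *v b) \<bullet> (Q *v b)"
        unfolding eq by (simp only: inner_symmetric_matrix[OF sQ] flip: matrix_vector_mul_assoc)
      finally show ?thesis .
    qed
    moreover have "(P *v b) \<bullet> (P *v b) - (Q *v b) \<bullet> (Q *v b)
        = l b * (b \<bullet> (P *v b) + b \<bullet> (Q *v b))"
      by (simp add: Pb inner_add_left inner_add_right inner_commute algebra_simps)
    moreover have "b \<bullet> (P *v b) + b \<bullet> (Q *v b) > 0"
      using P Q b0 by (simp add: positive_definite_def add_pos_pos)
    ultimately have "l b = 0" by simp
    then show "P *v b = Q *v b" by (simp add: Pb)
  qed
qed

lemma positive_definite_sqrt_unique:
  fixes W :: "real ^ 'n ^ 'n"
  assumes "positive_definite W"
  shows "\<exists>!R. positive_definite R \<and> R ** R = W"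
  by (metis assms positive_definite_sqrt_exists positive_definite_sqrt_inj)

lemma matrix_sqrt:
  fixes W :: "real ^ 'n ^ 'n"
  assumes "positive_definite W"
  shows "positive_definite (matrix_sqrt W)" "matrix_sqrt W ** matrix_sqrt W = W"
  using theI'[OF positive_definite_sqrt_unique[OF assms]] by (auto simp: matrix_sqrt_def)

end

theory Submission
  imports Defs
begin

text \<open>
  For $\mu = \tan\theta$ and $b = \tan\phi$ the fraction $(\mu - b)/(1 + b\mu)$ is
  $\tan(\theta - \phi)$, and $(1 - a\mu)/(a + \mu)$ is the negative of the same fraction with
  $b = 1/a$. Hence, with $F(b)$ the largest value of $|\tan(\theta - \phi)|$ over the spectrum,
  the bound is the product $F(\beta)\,F(1/\alpha)$, and its two factors can be minimized
  independently by the same number $c$ (lemma \<open>ttscsp_bound_eq\<close>).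

  Minimizing $F$ is a one-parameter Chebyshev problem. By monotonicity of the tangent only the
  extreme points $m = \mu_1$ and $M = \mu_n$ of the spectrum matter, and the optimal $c$ is the
  one that equalizes the deviations $(c - m)/(1 + cm)$ and $(M - c)/(1 + cM)$ (the tangent of
  the angle bisector). Moving $b$ to either side of $c$ strictly increases one of them, which
  makes the minimizer unique (lemma \<open>tan_radius_strict_min\<close>). Equalizing
  amounts to the quadratic $\eta c^2 + 2\gamma c - \eta = 0$, whose positive root is the
  reciprocal of $(\gamma + \sqrt{\gamma^2 + \eta^2})/\eta$. As $m < M$, the minimum of $F$ is
  positive, so a product of two values of $F$ is minimal only if both factors are.
\<close>

text \<open>
  A nonzero kernel vector of $xI - A$ exists exactly if $\det(xI - A) = 0$, so the roots of the
  characteristic polynomial are the spectrum.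
\<close>
lemma spectrum_eq_image_eigenvalues:
  fixes A :: "real ^ 'n ^ 'n"
  assumes "eigenvalues_with_multiplicity A \<mu>"
  shows "spectrum A = \<mu> ` {1..CARD('n)}"
proof -
  have "k \<in> spectrum A \<longleftrightarrow> k \<in> \<mu> ` {1..CARD('n)}" for k
  proof -
    have "(mat k :: real ^ 'n ^ 'n) *v v = k *\<^sub>R v" for v
      by (simp add: vec_eq_iff matrix_vector_mult_def mat_def if_distrib[of "\<lambda>x. x * _"]
          cong: if_cong)
    then have kv: "(mat k - A) *v v = k *\<^sub>R v - A *v v" for v
      by (simp add: matrix_vector_mult_diff_rdistrib)
    have "k \<in> spectrum A \<longleftrightarrow> (\<exists>v. v \<noteq> 0 \<and> (mat k - A) *v v = 0)"
      by (auto simp: spectrum_def kv)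
    also have "\<dots> \<longleftrightarrow> det (mat k - A) = 0"
      by (metis invertible_det_nz invertible_left_inverse matrix_left_invertible_ker)
    also have "\<dots> \<longleftrightarrow> k \<in> \<mu> ` {1..CARD('n)}"
      using assms by (auto simp: eigenvalues_with_multiplicity_def)
    finally show ?thesis .
  qed
  then show ?thesis by blast
qed

text \<open>
  The subtraction formula of the tangent, in terms of the tangents of the two angles.
\<close>
definition tan_diff :: "real \<Rightarrow> real \<Rightarrow> real" where
  "tan_diff x b = (x - b) / (1 + b * x)"

definition tan_radius :: "real set \<Rightarrow> real \<Rightarrow> real" where
  "tan_radius A b = (MAX x\<in>A. \<bar>tan_diff x b\<bar>)"

lemma tan_diff_swap: "tan_diff x b = - tan_diff b x"
  by (simp add: tan_diff_def mult.commute minus_divide_left)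

lemma tan_diff_reciprocal:
  assumes "0 < a"
  shows "tan_diff x (1 / a) = (a * x - 1) / (a + x)"
proof -
  have "x - 1 / a = (a * x - 1) / a" "1 + 1 / a * x = (a + x) / a"
    using assms by (simp_all add: field_simps)
  then show ?thesis using assms by (simp add: tan_diff_def)
qed

text \<open>
  The numerators cross-multiply to the difference $(y - x)(1 + b^2)$.
\<close>
lemma tan_diff_strict_mono:
  assumes "0 \<le> x" "x < y" "0 \<le> b"
  shows "tan_diff x b < tan_diff y b"
proof -
  have pos: "0 < 1 + b * x" "0 < 1 + b * y"
    using assms by (simp_all add: add_pos_nonneg)
  have "0 < (y - x) * (1 + b * b)"
    using assms by (intro mult_pos_pos) (simp_all add: add_pos_nonneg)
  then show ?thesis
    using pos by (simp add: tan_diff_def divide_simps) (simp add: algebra_simps)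
qed

lemma tan_diff_mono:
  assumes "0 \<le> x" "x \<le> y" "0 \<le> b"
  shows "tan_diff x b \<le> tan_diff y b"
  using tan_diff_strict_mono[of x y b] assms by (cases "x = y") auto

text \<open>
  The factor of the bound that depends on $\alpha$ is the factor that depends on $\beta$,
  evaluated at the complementary angle.
\<close>
lemma ttscsp_bound_eq:
  assumes "0 < a"
  shows "ttscsp_bound S a b = tan_radius (spectrum S) b * tan_radius (spectrum S) (1 / a)"
proof -
  have "(1 - a * x) / (a + x) = - tan_diff x (1 / a)" for x
    using assms by (simp add: tan_diff_reciprocal minus_divide_left)
  then show ?thesis
    by (simp add: ttscsp_bound_def tan_radius_def tan_diff_def)
qed

text \<open>
  At the equalizing point $c$ the deviations from the two ends of $A$ are opposite, so every
  point of $A$ deviates at most as much as the ends do.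
\<close>
lemma tan_radius_equalizer:
  assumes "finite A" "m \<in> A" "M \<in> A" "A \<subseteq> {m..M}" "0 \<le> m" "0 \<le> c"
    and eq: "tan_diff c m = tan_diff M c"
  shows "tan_radius A c = tan_diff M c"
  unfolding tan_radius_def
proof (rule Max_eqI)
  have bound: "\<bar>tan_diff x c\<bar> \<le> tan_diff M c" if "x \<in> A" for x
  proof -
    have "m \<le> x" "x \<le> M" using that assms(4) by auto
    then have "tan_diff m c \<le> tan_diff x c" "tan_diff x c \<le> tan_diff M c"
      using assms by (auto intro!: tan_diff_mono)
    then show ?thesis using eq tan_diff_swap[of m c] by linarith
  qed
  then show "y \<le> tan_diff M c" if "y \<in> (\<lambda>x. \<bar>tan_diff x c\<bar>) ` A" for y
    using that by blast
  have "\<bar>tan_diff M c\<bar> = tan_diff M c"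
    using bound[OF \<open>M \<in> A\<close>] by linarith
  then show "tan_diff M c \<in> (\<lambda>x. \<bar>tan_diff x c\<bar>) ` A"
    using \<open>M \<in> A\<close> by (intro image_eqI[of _ _ M]) simp_all
qed (use assms in simp)

text \<open>
  Increasing $b$ beyond the equalizing point $c$ moves it further away from $m$, and decreasing
  it moves it further away from $M$; either way one of the two equal deviations grows.
\<close>
lemma tan_radius_strict_min:
  assumes "finite A" "m \<in> A" "M \<in> A" "A \<subseteq> {m..M}" "0 \<le> m" "0 \<le> c"
    and "tan_diff c m = tan_diff M c"
    and "0 \<le> b" "b \<noteq> c"
  shows "tan_radius A c < tan_radius A b"
proof -
  have dev: "\<bar>tan_diff x b\<bar> \<le> tan_radius A b" if "x \<in> A" for x
    unfolding tan_radius_def using that assms(1) by (intro Max_ge) auto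
  have "0 \<le> M" using assms by auto
  consider "c < b" | "b < c" using \<open>b \<noteq> c\<close> by linarith
  then have "tan_diff M c < tan_radius A b"
  proof cases
    case 1
    then have "tan_diff c m < tan_diff b m"
      using assms by (intro tan_diff_strict_mono)
    then show ?thesis
      using dev[OF \<open>m \<in> A\<close>] assms(7) tan_diff_swap[of b m] by linarith
  next
    case 2
    then have "tan_diff b M < tan_diff c M"
      using assms \<open>0 \<le> M\<close> by (intro tan_diff_strict_mono)
    then show ?thesis
      using dev[OF \<open>M \<in> A\<close>] tan_diff_swap[of b M] tan_diff_swap[of c M] by linarith
  qed
  then show ?thesis using tan_radius_equalizer[OF assms(1-7)] by simp
qed

text \<open>
  A negative or zero common deviation would mean $M \<le> c \<le> m$.
\<close>
lemma tan_radius_equalizer_pos: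
  assumes "finite A" "m \<in> A" "M \<in> A" "A \<subseteq> {m..M}" "0 \<le> m" "0 \<le> c"
    and "tan_diff c m = tan_diff M c" and "m < M"
  shows "0 < tan_radius A c"
proof (rule ccontr)
  assume "\<not> 0 < tan_radius A c"
  then have le: "tan_diff M c \<le> 0" "tan_diff c m \<le> 0"
    using tan_radius_equalizer[OF assms(1-7)] assms(7) by simp_all
  have "0 < 1 + c * M" "0 < 1 + m * c"
    using assms by (simp_all add: add_pos_nonneg)
  with le have "M \<le> c" "c \<le> m"
    by (simp_all add: tan_diff_def divide_le_0_iff)
  with \<open>m < M\<close> show False by linarith
qed

text \<open>
  The number $a$ is the positive root of $\eta a^2 - 2\gamma a - \eta = 0$, and clearing
  denominators turns the equalizing condition at $1/a$ into this quadratic.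
\<close>
lemma equalizer_reciprocal:
  fixes m M :: real
  defines "\<eta> \<equiv> m + M" and "\<gamma> \<equiv> 1 - m * M"
  defines "a \<equiv> (\<gamma> + sqrt (\<gamma>\<^sup>2 + \<eta>\<^sup>2)) / \<eta>"
  assumes "0 \<le> m" "m < M"
  shows "0 < a" "tan_diff (1 / a) m = tan_diff M (1 / a)"
proof -
  define s where "s = sqrt (\<gamma>\<^sup>2 + \<eta>\<^sup>2)"
  have "0 < \<eta>" using assms by simp
  have s2: "s\<^sup>2 = \<gamma>\<^sup>2 + \<eta>\<^sup>2" by (simp add: s_def)
  have "sqrt (\<gamma>\<^sup>2) < s"
    unfolding s_def using \<open>0 < \<eta>\<close> by (intro real_sqrt_less_mono) simp
  then have "0 < \<gamma> + s" by simp
  then show "0 < a" using \<open>0 < \<eta>\<close> by (simp add: a_def s_def)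
  have "\<eta> * a = \<gamma> + s" using \<open>0 < \<eta>\<close> by (simp add: a_def s_def)
  then have "(\<eta> * a - \<gamma>)\<^sup>2 = \<gamma>\<^sup>2 + \<eta>\<^sup>2" using s2 by simp
  then have "\<eta> * (\<eta> * a\<^sup>2 - 2 * \<gamma> * a - \<eta>) = 0"
    by (simp add: power2_eq_square algebra_simps)
  then have quad: "\<eta> * a\<^sup>2 - 2 * \<gamma> * a - \<eta> = 0" using \<open>0 < \<eta>\<close> by simp
  have "tan_diff (1 / a) m = (1 - a * m) / (a + m)" "tan_diff M (1 / a) = (a * M - 1) / (a + M)"
    using \<open>0 < a\<close> by (simp_all add: tan_diff_swap[of _ m] tan_diff_reciprocal minus_divide_left)
  moreover have "(1 - a * m) * (a + M) = (a * M - 1) * (a + m)"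
    using quad unfolding \<eta>_def \<gamma>_def by (simp add: power2_eq_square algebra_simps)
  moreover have "0 < a + m" "0 < a + M" using \<open>0 < a\<close> assms by simp_all
  ultimately show "tan_diff (1 / a) m = tan_diff M (1 / a)"
    by (simp add: frac_eq_eq)
qed

text \<open>
  If a product is minimal and one factor exceeded the positive minimum $F(c)$, the product
  would exceed $F(c)^2$.
\<close>
lemma is_arg_min_separable_product:
  fixes F :: "real \<Rightarrow> real"
  assumes c: "0 < c" "0 < F c" and min: "\<And>b. 0 < b \<Longrightarrow> b \<noteq> c \<Longrightarrow> F c < F b"
    and f: "\<And>a b. 0 < a \<Longrightarrow> f a b = F b * F (1 / a)"
  shows "is_arg_min (\<lambda>(a, b). f a b) (\<lambda>(a, b). a > 0 \<and> b > 0) (\<alpha>, \<beta>) \<longleftrightarrow>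
    \<alpha> = 1 / c \<and> \<beta> = c"
proof -
  have le: "F c \<le> F b" if "0 < b" for b
    using min[OF that] by (cases "b = c") auto
  have lower: "F c * F c \<le> f a b" if "0 < a" "0 < b" for a b
    using f[OF that(1)] le[OF that(2)] le[of "1 / a"] that c by (auto intro!: mult_mono)
  have at_c: "f (1 / c) c = F c * F c" using f c by simp
  show ?thesis
  proof
    assume *: "is_arg_min (\<lambda>(a, b). f a b) (\<lambda>(a, b). a > 0 \<and> b > 0) (\<alpha>, \<beta>)"
    then have pos: "0 < \<alpha>" "0 < \<beta>" by (auto simp: is_arg_min_def)
    have "\<not> f (1 / c) c < f \<alpha> \<beta>"
      using * c by (auto simp: is_arg_min_def)
    then have upper: "F \<beta> * F (1 / \<alpha>) \<le> F c * F c"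
      using at_c f[OF pos(1)] by simp
    have "\<beta> = c"
    proof (rule ccontr)
      assume "\<beta> \<noteq> c"
      then have "F c * F c < F \<beta> * F (1 / \<alpha>)"
        using min[OF pos(2)] le[of "1 / \<alpha>"] pos c by (intro mult_less_le_imp_less) auto
      with upper show False by linarith
    qed
    moreover have "1 / \<alpha> = c"
    proof (rule ccontr)
      assume "1 / \<alpha> \<noteq> c"
      then have "F c * F c < F \<beta> * F (1 / \<alpha>)"
        using min[of "1 / \<alpha>"] le[OF pos(2)] pos c by (intro mult_le_less_imp_less) auto
      with upper show False by linarith
    qed
    ultimately show "\<alpha> = 1 / c \<and> \<beta> = c" by auto
  next
    assume "\<alpha> = 1 / c \<and> \<beta> = c"
    then show "is_arg_min (\<lambda>(a, b). f a b) (\<lambda>(a, b). a > 0 \<and> b > 0) (\<alpha>, \<beta>)"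
      using c at_c by (auto simp: is_arg_min_def dest: lower[THEN leD])
  qed
qed

theorem theorem2:
  fixes W T S :: "real ^ 'n ^ 'n" and \<mu> :: "nat \<Rightarrow> real" and r n :: nat
    and \<eta> \<gamma> \<alpha> \<beta> :: real
  assumes "n = CARD('n)"
    and "positive_definite W"
    and "positive_semidefinite T"
    and "S = matrix_inv (matrix_sqrt W) ** T ** matrix_inv (matrix_sqrt W)"
    and "eigenvalues_with_multiplicity S \<mu>"
    and "mono_on {1..n} \<mu>"
    and "1 \<le> r" and "r < n"
    and "0 \<le> \<mu> 1" and "\<mu> r < 1" and "1 \<le> \<mu> (r + 1)"
    and "\<eta> = \<mu> 1 + \<mu> n"
    and "\<gamma> = 1 - \<mu> 1 * \<mu> n"
  shows "is_arg_min (\<lambda>(a, b). ttscsp_bound S a b) (\<lambda>(a, b). a > 0 \<and> b > 0) (\<alpha>, \<beta>) \<longleftrightarrow>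
    \<alpha> = (\<gamma> + sqrt (\<gamma>\<^sup>2 + \<eta>\<^sup>2)) / \<eta> \<and> \<beta> = 1 / \<alpha>"
proof -
  define a where "a = (\<gamma> + sqrt (\<gamma>\<^sup>2 + \<eta>\<^sup>2)) / \<eta>"
  have \<mu>_le: "\<mu> i \<le> \<mu> j" if "1 \<le> i" "i \<le> j" "j \<le> n" for i j
    using \<open>mono_on {1..n} \<mu>\<close> that by (auto simp: mono_on_def)
  have "\<mu> 1 \<le> \<mu> r" "\<mu> (r + 1) \<le> \<mu> n"
    using assms(7,8) by (auto intro!: \<mu>_le)
  then have less: "\<mu> 1 < \<mu> n" using assms(10,11) by linarith
  have spec: "spectrum S = \<mu> ` {1..n}"
    using spectrum_eq_image_eigenvalues[OF assms(5)] assms(1) by simp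
  have A: "finite (spectrum S)" "\<mu> 1 \<in> spectrum S" "\<mu> n \<in> spectrum S"
      "spectrum S \<subseteq> {\<mu> 1..\<mu> n}"
    using assms(7,8) by (auto simp: spec intro!: \<mu>_le)
  have a: "0 < a" and eq: "tan_diff (1 / a) (\<mu> 1) = tan_diff (\<mu> n) (1 / a)"
    using equalizer_reciprocal[OF assms(9) less] by (simp_all add: a_def assms(12,13))
  have "0 \<le> 1 / a" using a by simp
  note equalizer = A assms(9) this eq
  have "is_arg_min (\<lambda>(a, b). ttscsp_bound S a b) (\<lambda>(a, b). a > 0 \<and> b > 0) (\<alpha>, \<beta>) \<longleftrightarrow>
      \<alpha> = 1 / (1 / a) \<and> \<beta> = 1 / a"
    using a tan_radius_equalizer_pos[OF equalizer less] tan_radius_strict_min[OF equalizer]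
    by (intro is_arg_min_separable_product[where F = "tan_radius (spectrum S)"])
      (simp_all add: ttscsp_bound_eq)
  then show ?thesis unfolding a_def by auto
qed

end
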